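(* Let $p$ be an odd prime and let $F\colon\mathbb{F}_{p^n}\to\mathbb{F}_{p^n}$ be a plateaued function such that $F(x)=F(-x)$ for all $x\in\mathbb{F}_{p^n}$. Then $F$ is planar if and only if $F$ is $2$-to-$1$.
   Context: Let $\zeta_p=e^{2\pi i/p}$ and let $\operatorname{Tr}$ be the absolute trace $\mathbb{F}_{p^n}\to\mathbb{F}_p$. The Walsh transform of $F$ is $W_F(b,a)=\sum_{x\in\mathbb{F}_{p^n}}\zeta_p^{\operatorname{Tr}(bF(x))-\operatorname{Tr}(ax)}$. $F$ is plateaued if for every $b\in\mathbb{F}_{p^n}^*$ there is an integer $s_b$ with $0\le s_b\le n$ such that $|W_F(b,a)|\in\{0,p^{(n+s_b)/2}\}$ for all $a\in\mathbb{F}_{p^n}$. $F$ is $2$-to-$1$ if exactly one element of $\mathbb{F}_{p^n}$ has exactly one preimage and $(p^n-1)/2$ elements have exactly $2$ preimages. $F$ is planar if for every $a\in\mathbb{F}_{p^n}^*$ and every $b\in\mathbb{F}_{p^n}$ the equation $F(x+a)-F(x)=b$ has exactly one solution $x$. *)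

theory Defs
  imports "HOL-Analysis.Analysis" "HOL-Number_Theory.Number_Theory"
begin

text \<open>
  The field with \<open>p ^ n\<close> elements is a type \<open>'a\<close> of class \<^class>\<open>finite_field\<close> with
  \<open>CARD('a) = p ^ n\<close>; the parameters \<open>p\<close> and \<open>n\<close> below are meant to be these numbers.
\<close>

text \<open>
  The trace is an element of \<open>'a\<close>; it lies in the prime subfield, whose elements are
  \<open>of_nat k\<close> for \<open>k < p\<close> (see \<open>ex1_prime_field_rep_abs_trace\<close> below).
\<close>
definition abs_trace :: "nat \<Rightarrow> nat \<Rightarrow> 'a :: finite_field \<Rightarrow> 'a" where
  "abs_trace p n x = (\<Sum>i<n. x ^ (p ^ i))"

text \<open>Only meaningful for \<open>y\<close> in the prime subfield.\<close>
definition prime_field_rep :: "nat \<Rightarrow> 'a :: finite_field \<Rightarrow> nat" where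
  "prime_field_rep p y = (THE k. k < p \<and> of_nat k = y)"

definition zeta :: "nat \<Rightarrow> complex" where
  "zeta p = exp (2 * of_real pi * \<i> / of_nat p)"

definition walsh_transform ::
    "nat \<Rightarrow> nat \<Rightarrow> ('a :: finite_field \<Rightarrow> 'a) \<Rightarrow> 'a \<Rightarrow> 'a \<Rightarrow> complex" where
  "walsh_transform p n F b a =
     (\<Sum>x\<in>UNIV. zeta p powi
        (int (prime_field_rep p (abs_trace p n (b * F x)))
         - int (prime_field_rep p (abs_trace p n (a * x)))))"

definition plateaued :: "nat \<Rightarrow> nat \<Rightarrow> ('a :: finite_field \<Rightarrow> 'a) \<Rightarrow> bool" where
  "plateaued p n F \<longleftrightarrow>
     (\<forall>b. b \<noteq> 0 \<longrightarrow>
        (\<exists>s::nat. s \<le> n \<and>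
           (\<forall>a. cmod (walsh_transform p n F b a) \<in> {0, real p powr ((real n + real s) / 2)})))"

definition two_to_one :: "('a :: finite_field \<Rightarrow> 'a) \<Rightarrow> bool" where
  "two_to_one F \<longleftrightarrow>
     card {y. card (F -` {y}) = 1} = 1 \<and>
     2 * card {y. card (F -` {y}) = 2} = CARD('a) - 1"

definition planar :: "('a :: finite_field \<Rightarrow> 'a) \<Rightarrow> bool" where
  "planar F \<longleftrightarrow> (\<forall>a b. a \<noteq> 0 \<longrightarrow> (\<exists>!x. F (x + a) - F x = b))"

lemma CHAR_eq_if_card_eq_power:
  assumes "prime p" "CARD('a :: finite_field) = p ^ n"
  shows "CHAR('a) = p"
proof -
  have "CHAR('a) dvd p ^ n"
    using CHAR_dvd_CARD[where 'a = 'a] assms by simp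
  moreover have "prime CHAR('a)" by simp
  ultimately show ?thesis
    using assms(1) prime_dvd_power primes_dvd_imp_eq by blast
qed

lemma abs_trace_power_p:
  fixes x :: "'a :: finite_field"
  assumes "prime p" "CARD('a) = p ^ n"
  shows "abs_trace p n x ^ p = abs_trace p n x"
proof -
  have p: "CHAR('a) = p" using CHAR_eq_if_card_eq_power assms by blast
  have "abs_trace p n x ^ p = (\<Sum>i<n. (x ^ p ^ i) ^ p)"
    unfolding abs_trace_def p[symmetric] by (rule freshmans_dream_sum) auto
  also have "\<dots> = (\<Sum>i<n. x ^ p ^ Suc i)"
    by (simp add: power_mult[symmetric] mult.commute)
  also have "\<dots> = abs_trace p n x + x ^ p ^ n - x ^ p ^ 0"
    unfolding abs_trace_def
    using sum.lessThan_Suc[of "\<lambda>i. x ^ p ^ i" n] sum.lessThan_Suc_shift[of "\<lambda>i. x ^ p ^ i" n]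
    by (simp add: algebra_simps)
  also have "x ^ p ^ n = x"
    using finite_field_power_card_eq_same[of x] assms(2) by simp
  finally show ?thesis by simp
qed

lemma ex1_prime_field_rep_abs_trace:
  fixes x :: "'a :: finite_field"
  assumes "prime p" "CARD('a) = p ^ n"
  shows "\<exists>!k. k < p \<and> of_nat k = abs_trace p n x"
proof -
  have p: "CHAR('a) = p" using CHAR_eq_if_card_eq_power assms by blast
  have inj: "inj_on (of_nat :: nat \<Rightarrow> 'a) {..<p}"
    by (intro inj_onI) (auto simp: of_nat_eq_iff_cong_CHAR p cong_def)
  have p2: "p \<ge> 2" using assms(1) prime_ge_2_nat by blast
  define f :: "'a poly" where "f = Polynomial.monom 1 p - Polynomial.monom 1 1"
  have deg: "degree f = p" "f \<noteq> 0"
  proof -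
    have "Polynomial.coeff f p = 1" using p2 by (simp add: f_def)
    moreover have "degree f \<le> p"
      unfolding f_def using p2 by (intro degree_diff_le) (auto intro: order.trans[OF degree_monom_le])
    ultimately show "degree f = p" "f \<noteq> 0" by (auto intro!: antisym le_degree)
  qed
  have frob: "(of_nat k :: 'a) ^ p = of_nat k" for k
  proof (induction k)
    case 0
    then show ?case using p2 by simp
  next
    case (Suc k)
    have "(1 + of_nat k :: 'a) ^ p = 1 ^ p + of_nat k ^ p"
      unfolding p[symmetric] by (rule freshmans_dream) auto
    then show ?case using Suc by simp
  qed
  have "of_nat ` {..<p} = {y. poly f y = 0}"
  proof (rule card_seteq)
    show "finite {y. poly f y = 0}" by simp
    show "of_nat ` {..<p} \<subseteq> {y. poly f y = 0}"
      by (auto simp: f_def poly_monom frob)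
    show "card {y. poly f y = 0} \<le> card ((of_nat :: nat \<Rightarrow> 'a) ` {..<p})"
      using card_poly_roots_bound[OF deg(2)] deg(1) card_image[OF inj] by simp
  qed
  moreover have "poly f (abs_trace p n x) = 0"
    using abs_trace_power_p[OF assms] by (simp add: f_def poly_monom)
  ultimately have "abs_trace p n x \<in> of_nat ` {..<p}" by blast
  then show ?thesis using inj by (auto simp: inj_on_def)
qed

end

theory Submission
  imports Defs
begin

text \<open>
  Let \<open>q = p ^ n\<close>. If \<open>F\<close> is planar and even, then \<open>F x = F y\<close> with \<open>x \<noteq> y\<close> makes both \<open>x\<close> and
  \<open>- y\<close> solutions \<open>z\<close> of \<open>F (z + (y - x)) = F z\<close>, so the fibres of \<open>F\<close> are the sets \<open>{x, - x}\<close>.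

  Conversely let \<open>F\<close> be 2-to-1. Then \<open>W(b, 0)\<close> is a root of unity plus twice an algebraic integer,
  hence nonzero, so \<open>\<bar>W(b, 0)\<bar>\<^sup>2 = p ^ (n + s_b) \<ge> q\<close> for \<open>b \<noteq> 0\<close>. Counting the pairs with
  \<open>F x = F y\<close> shows that \<open>\<bar>W(b, 0)\<bar>\<^sup>2\<close> is \<open>q\<close> on average over \<open>b \<noteq> 0\<close>, so every \<open>s_b\<close> is \<open>0\<close>.
  By Parseval \<open>\<bar>W(b, a)\<bar>\<^sup>2 = q\<close> for all \<open>a\<close> and all \<open>b \<noteq> 0\<close>, which forces the derivatives of \<open>F\<close>
  to be permutations.
\<close>

section \<open>Parity of sums of roots of unity\<close>

text \<open>The set \<open>{1}\<close> is linearly independent over the rationals, so a functional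
  can be prescribed on it and extended. It stands in for the ring of algebraic integers: it carries
  relations between roots of unity over to the rationals, where divisibility by powers of
  \<open>2\<close> can be tested.\<close>

lemma rat_linear_functional_exists:
  "\<exists>\<phi> :: complex \<Rightarrow> rat.
    (\<forall>x y. \<phi> (x + y) = \<phi> x + \<phi> y) \<and> (\<forall>r x. \<phi> (of_rat r * x) = r * \<phi> x) \<and> \<phi> 1 = 1"
proof -
  interpret vector_space_pair "\<lambda>(r::rat) (x::complex). of_rat r * x" "\<lambda>(r::rat) (x::rat). r * x"
    by unfold_locales (auto simp: algebra_simps of_rat_add of_rat_mult)
  have "\<not> vs1.dependent {1}" by (simp add: vs1.dependent_single)
  from linear_independent_extend[OF this, of "\<lambda>_. 1"]
  obtain g where g: "Vector_Spaces.linear (\<lambda>(r::rat) (x::complex). of_rat r * x) (\<lambda>(r::rat) (x::rat). r * x) g"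
    and "g 1 = 1" by auto
  with linear_add[OF g] linear_scale[OF g] show ?thesis by blast
qed

lemma rat_common_denominator:
  fixes f :: "'b \<Rightarrow> rat"
  assumes "finite A"
  shows "\<exists>D::nat. D > 0 \<and> (\<forall>x\<in>A. of_nat D * f x \<in> \<int>)"
  using assms
proof (induction A rule: finite_induct)
  case empty
  show ?case by (rule exI[of _ 1]) auto
next
  case (insert a A)
  then obtain D :: nat where D: "D > 0" "\<forall>x\<in>A. of_nat D * f x \<in> \<int>"
    by blast
  obtain k l where kl: "quotient_of (f a) = (k, l)" by fastforce
  have l: "l > 0" "f a = of_int k / of_int l"
    using quotient_of_denom_pos[OF kl] quotient_of_div[OF kl] by auto
  have "of_nat (nat l * D) * f x \<in> \<int>" if "x \<in> insert a A" for x
  proof (cases "x = a")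
    case True
    have "of_nat (nat l * D) * f a = of_nat D * of_int k"
      using l by (simp add: of_nat_nat)
    then show ?thesis by (simp only: True Ints_mult Ints_of_nat Ints_of_int)
  next
    case False
    have "of_nat (nat l * D) * f x = of_nat (nat l) * (of_nat D * f x)" by simp
    then show ?thesis using D(2) that False by (metis Ints_mult Ints_of_nat insertE)
  qed
  then show ?case using l D by (intro exI[of _ "nat l * D"]) auto
qed

text \<open>
  Otherwise the values on the \<open>m\<close>-th roots of unity of a rational functional \<open>\<phi>\<close> with
  \<open>\<phi> 1 = 1\<close> would, after clearing denominators, be divisible by every power of \<open>2\<close>.
\<close>
lemma root_of_unity_plus_even_sum_nonzero:
  fixes u :: complex
  assumes "m > 0" and u: "u ^ m = 1" and f: "\<And>x. x \<in> A \<Longrightarrow> f x ^ m = 1"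
  shows "u + 2 * (\<Sum>x\<in>A. f x) \<noteq> 0"
proof
  assume eq: "u + 2 * (\<Sum>x\<in>A. f x) = 0"
  have u0: "u \<noteq> 0" using u \<open>m > 0\<close> by (auto simp: power_0_left)
  obtain \<phi> :: "complex \<Rightarrow> rat" where add: "\<And>x y. \<phi> (x + y) = \<phi> x + \<phi> y"
    and scale: "\<And>r x. \<phi> (of_rat r * x) = r * \<phi> x" and one: "\<phi> 1 = 1"
    using rat_linear_functional_exists by metis
  have zero: "\<phi> 0 = 0" using add[of 0 0] by simp
  have sum: "\<phi> (\<Sum>x\<in>B. g x) = (\<Sum>x\<in>B. \<phi> (g x))" for B and g :: "'a \<Rightarrow> complex"
    by (induction B rule: infinite_finite_induct) (auto simp: add zero)
  have "finite {w::complex. w ^ m = 1}"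
    using finite_roots_unity[of m] \<open>m > 0\<close> by simp
  from rat_common_denominator[OF this, of \<phi>]
  obtain D :: nat where D: "D > 0" "\<forall>w. w ^ m = 1 \<longrightarrow> of_nat D * \<phi> w \<in> \<int>"
    by auto
  \<comment> \<open>Multiplying the assumed relation by \<open>w / u\<close> writes \<open>w\<close>
    as \<open>- 2\<close> times a sum of elements \<open>w * f x / u\<close>. These are again
    \<open>m\<close>-th roots of unity if \<open>w\<close> is one, so each application gains a
    factor \<open>2\<close>.\<close>
  have step: "\<phi> w = - 2 * (\<Sum>x\<in>A. \<phi> (w * f x / u))" for w
  proof -
    have "w = (w / u) * u" using u0 by simp
    also have "\<dots> = w / u * (- 2 * (\<Sum>x\<in>A. f x))"
      by (rule arg_cong[of _ _ "(*) (w / u)"]) (use eq in \<open>simp add: eq_neg_iff_add_eq_0\<close>)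
    also have "\<dots> = of_rat (- 2) * (\<Sum>x\<in>A. w * f x / u)"
      by (simp add: of_rat_minus flip: sum_distrib_left sum_divide_distrib)
    finally have "\<phi> w = \<phi> (of_rat (- 2) * (\<Sum>x\<in>A. w * f x / u))" by (rule arg_cong)
    then show ?thesis unfolding scale sum .
  qed
  have "\<exists>j. of_nat D * \<phi> w = 2 ^ k * of_int j" if "w ^ m = 1" for w k
    using that
  proof (induction k arbitrary: w)
    case 0
    then show ?case using D(2) by (auto elim!: Ints_cases)
  next
    case (Suc k)
    have "\<forall>x\<in>A. \<exists>j. of_nat D * \<phi> (w * f x / u) = 2 ^ k * of_int j"
      using Suc.prems f u by (auto intro!: Suc.IH simp: power_mult_distrib power_divide)
    then obtain j where j: "\<And>x. x \<in> A \<Longrightarrow> of_nat D * \<phi> (w * f x / u) = 2 ^ k * of_int (j x)"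
      by metis
    have "of_nat D * \<phi> w = - 2 * (\<Sum>x\<in>A. of_nat D * \<phi> (w * f x / u))"
      by (subst step) (simp flip: sum_distrib_left)
    also have "\<dots> = 2 ^ Suc k * of_int (- (\<Sum>x\<in>A. j x))"
      by (simp add: j flip: sum_distrib_left)
    finally show ?case by blast
  qed
  \<comment> \<open>Since \<open>\<phi> 1 = 1\<close>, taking \<open>w = 1\<close> and
    \<open>k = D\<close> gives \<open>2 ^ D dvd D\<close>, which \<open>0 < D < 2 ^ D\<close> rules
    out.\<close>
  from this[of 1 D] obtain j where "(of_nat D :: rat) = 2 ^ D * of_int j"
    by (auto simp: one)
  then have "(of_int (int D) :: rat) = of_int (2 ^ D * j)" by simp
  then have "int D = 2 ^ D * j" by (simp only: of_int_eq_iff)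
  then have "2 ^ D dvd int D" by simp
  then have "(2::int) ^ D \<le> int D" using D(1) by (intro zdvd_imp_le) auto
  moreover have "D < 2 ^ D" by (rule less_exp)
  ultimately show False by (simp add: not_le[symmetric])
qed

section \<open>Additive characters and Fourier identities\<close>

locale additive_character =
  fixes \<psi> :: "'a :: finite_field \<Rightarrow> complex"
  assumes char_add: "\<psi> (x + y) = \<psi> x * \<psi> y"
    and char_0: "\<psi> 0 = 1"
    and nontrivial: "\<exists>c. \<psi> c \<noteq> 1"
begin

text \<open>The characteristic divides \<open>CARD('a)\<close>, so \<open>CARD('a)\<close> times any
  element is \<open>0\<close>. Thus all values are roots of unity of one common exponent.\<close>

lemma char_power_card: "\<psi> x ^ CARD('a) = 1"
proof -
  have "\<psi> (of_nat k * x) = \<psi> x ^ k" for k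
    by (induction k) (auto simp: char_0 char_add algebra_simps)
  from this[of "CARD('a)"] have "\<psi> (of_nat CARD('a) * x) = \<psi> x ^ CARD('a)" .
  moreover have "(of_nat CARD('a) :: 'a) = 0"
    using CHAR_dvd_CARD[where 'a = 'a] by (simp only: of_nat_eq_0_iff_char_dvd)
  ultimately show ?thesis by (simp only: mult_zero_left char_0)
qed

lemma norm_char: "cmod (\<psi> x) = 1"
proof -
  have "cmod (\<psi> x) ^ CARD('a) = 1 ^ CARD('a)"
    by (metis char_power_card norm_power norm_one power_one)
  then show ?thesis by (rule power_eq_imp_eq_base) simp_all
qed

lemma char_minus: "\<psi> (- x) = cnj (\<psi> x)"
proof -
  have "\<psi> x * \<psi> (- x) = 1" using char_add[of x "- x"] by (simp add: char_0)
  moreover have "\<psi> x * cnj (\<psi> x) = 1" by (simp add: complex_norm_square[symmetric] norm_char)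
  moreover have "\<psi> x \<noteq> 0" using norm_char[of x] by auto
  ultimately show ?thesis by (metis mult_left_cancel)
qed

text \<open>Orthogonality: for \<open>x \<noteq> 0\<close> the shift of \<open>a\<close> by
  \<open>c / x\<close> permutes the field and multiplies the sum by
  \<open>\<psi> c \<noteq> 1\<close>.\<close>

lemma sum_char: "(\<Sum>a\<in>UNIV. \<psi> (a * x)) = (if x = 0 then of_nat CARD('a) else 0)"
proof (cases "x = 0")
  case True
  then show ?thesis by (simp add: char_0)
next
  case False
  obtain c where c: "\<psi> c \<noteq> 1" using nontrivial by blast
  have "(\<Sum>a\<in>UNIV. \<psi> (a * x)) = (\<Sum>a\<in>UNIV. \<psi> ((a + c / x) * x))"
    by (rule sum.reindex_bij_witness[of _ "\<lambda>a. a + c / x" "\<lambda>a. a - c / x"]) auto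
  also have "\<dots> = \<psi> c * (\<Sum>a\<in>UNIV. \<psi> (a * x))"
    using False by (simp add: sum_distrib_left char_add ring_distribs mult_ac)
  finally show ?thesis using c False by auto
qed

text \<open>Expand the square as a double sum and sum over \<open>a\<close> first; by orthogonality
  only pairs with \<open>h x + d = h y\<close> survive. Taking \<open>h x = - x\<close> gives the
  autocorrelation at shift \<open>d\<close>, and Parseval for \<open>d = 0\<close>; taking
  \<open>g = 1\<close>, \<open>h = F\<close>, \<open>d = 0\<close> counts collisions of
  \<open>F\<close>.\<close>

lemma sum_norm_square_char_sum:
  fixes g :: "'b :: finite \<Rightarrow> complex"
  shows "(\<Sum>a\<in>UNIV. of_real ((cmod (\<Sum>x\<in>UNIV. g x * \<psi> (a * h x)))\<^sup>2) * \<psi> (a * d)) =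
    of_nat CARD('a) * (\<Sum>x\<in>UNIV. \<Sum>y\<in>UNIV. if h x + d = h y then g x * cnj (g y) else 0)"
proof -
  have "of_real ((cmod (\<Sum>x\<in>UNIV. g x * \<psi> (a * h x)))\<^sup>2) * \<psi> (a * d) =
      (\<Sum>x\<in>UNIV. \<Sum>y\<in>UNIV. g x * cnj (g y) * \<psi> (a * (h x + d - h y)))" for a
  proof -
    have "\<psi> (a * h x) * \<psi> (- (a * h y)) * \<psi> (a * d) = \<psi> (a * (h x + d - h y))" for x y
      by (simp flip: char_add add: algebra_simps)
    moreover have "g x * \<psi> (a * h x) * cnj (g y * \<psi> (a * h y)) * \<psi> (a * d) =
        g x * cnj (g y) * (\<psi> (a * h x) * \<psi> (- (a * h y)) * \<psi> (a * d))" for x y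
      by (simp only: char_minus complex_cnj_mult mult_ac)
    ultimately show ?thesis
      unfolding complex_norm_square cnj_sum sum_product by (simp only: sum_distrib_right)
  qed
  then have "(\<Sum>a\<in>UNIV. of_real ((cmod (\<Sum>x\<in>UNIV. g x * \<psi> (a * h x)))\<^sup>2) * \<psi> (a * d)) =
      (\<Sum>a\<in>UNIV. \<Sum>x\<in>UNIV. \<Sum>y\<in>UNIV. g x * cnj (g y) * \<psi> (a * (h x + d - h y)))" by simp
  also have "\<dots> = (\<Sum>x\<in>UNIV. \<Sum>a\<in>UNIV. \<Sum>y\<in>UNIV. g x * cnj (g y) * \<psi> (a * (h x + d - h y)))"
    by (rule sum.swap)
  also have "\<dots> = (\<Sum>x\<in>UNIV. \<Sum>y\<in>UNIV. \<Sum>a\<in>UNIV. g x * cnj (g y) * \<psi> (a * (h x + d - h y)))"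
    by (intro sum.cong refl sum.swap)
  also have "\<dots> = (\<Sum>x\<in>UNIV. \<Sum>y\<in>UNIV. g x * cnj (g y) * (if h x + d - h y = 0 then of_nat CARD('a) else 0))"
    by (simp only: sum_char flip: sum_distrib_left)
  also have "\<dots> = of_nat CARD('a) * (\<Sum>x\<in>UNIV. \<Sum>y\<in>UNIV. if h x + d = h y then g x * cnj (g y) else 0)"
    unfolding sum_distrib_left by (intro sum.cong refl) (simp add: algebra_simps)
  finally show ?thesis .
qed

text \<open>Summing \<open>\<psi> (b * (G x - c))\<close> over all \<open>b\<close> and
  \<open>x\<close> gives \<open>CARD('a)\<close> times the number of solutions of
  \<open>G x = c\<close>. Only \<open>b = 0\<close> contributes, and it contributes
  \<open>CARD('a)\<close>.\<close>

lemma ex1_if_char_sums_vanish: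
  fixes G :: "'a \<Rightarrow> 'a"
  assumes "\<And>b. b \<noteq> 0 \<Longrightarrow> (\<Sum>x\<in>UNIV. \<psi> (b * G x)) = 0"
  shows "\<exists>!x. G x = c"
proof -
  have "(\<Sum>b\<in>UNIV. \<Sum>x\<in>UNIV. \<psi> (b * (G x - c))) = (\<Sum>b\<in>(UNIV :: 'a set). if b = 0 then of_nat CARD('a) else 0)"
  proof (intro sum.cong refl)
    fix b :: 'a
    have "(\<Sum>x\<in>UNIV. \<psi> (b * (G x - c))) = (\<Sum>x\<in>UNIV. \<psi> (b * G x)) * \<psi> (- (b * c))"
      by (simp add: sum_distrib_right right_diff_distrib flip: char_add)
    then show "(\<Sum>x\<in>UNIV. \<psi> (b * (G x - c))) = (if b = 0 then of_nat CARD('a) else 0)"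
      using assms[of b] by (simp add: char_0)
  qed
  also have "\<dots> = of_nat CARD('a)" by simp
  also have "(\<Sum>b\<in>UNIV. \<Sum>x\<in>UNIV. \<psi> (b * (G x - c))) = (\<Sum>x\<in>UNIV. \<Sum>b\<in>UNIV. \<psi> (b * (G x - c)))"
    by (rule sum.swap)
  also have "\<dots> = (\<Sum>x\<in>UNIV. if G x = c then of_nat CARD('a) else 0)"
    by (simp add: sum_char)
  also have "\<dots> = of_nat CARD('a) * of_nat (card {x. G x = c})"
    by (simp add: sum.If_cases mult.commute)
  finally have "card {x. G x = c} = 1"
    by (simp flip: of_nat_mult)
  then obtain z where "{x. G x = c} = {z}" by (rule card_1_singletonE)
  then show ?thesis by (intro ex1I[of _ z]) auto
qed

text \<open>Wiener-Khinchin: the autocorrelation of \<open>\<lambda>x. \<psi> (b * F x)\<close> is the transform of its flat spectrum.\<close>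
lemma planar_if_flat_spectrum:
  fixes F :: "'a \<Rightarrow> 'a"
  assumes flat: "\<And>b a. b \<noteq> 0 \<Longrightarrow> (cmod (\<Sum>x\<in>UNIV. \<psi> (b * F x - a * x)))\<^sup>2 = of_nat CARD('a)"
  shows "planar F"
  unfolding planar_def
proof (intro allI impI)
  fix d c :: 'a assume "d \<noteq> 0"
  show "\<exists>!x. F (x + d) - F x = c"
  proof (rule ex1_if_char_sums_vanish)
    fix b :: 'a assume b: "b \<noteq> 0"
    have split: "\<psi> (b * F x - a * x) = \<psi> (b * F x) * \<psi> (a * - x)" for a x
      by (simp flip: char_add)
    \<comment> \<open>Flatness makes the squared norms constant in \<open>a\<close>, so what remains
      of the weighted sum is a full character sum at \<open>d \<noteq> 0\<close>.\<close>
    have "of_nat CARD('a) * (\<Sum>a\<in>UNIV. \<psi> (a * d)) =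
        of_nat CARD('a) * (\<Sum>x\<in>UNIV. \<Sum>y\<in>UNIV. if - x + d = - y then \<psi> (b * F x) * cnj (\<psi> (b * F y)) else 0)"
      unfolding sum_norm_square_char_sum[symmetric] split[symmetric]
      by (simp only: flat[OF b] sum_distrib_left of_real_of_nat_eq)
    also have "(\<Sum>a\<in>UNIV. \<psi> (a * d)) = 0" using \<open>d \<noteq> 0\<close> by (simp add: sum_char)
    also have "(\<Sum>x\<in>UNIV. \<Sum>y\<in>UNIV. if - x + d = - y then \<psi> (b * F x) * cnj (\<psi> (b * F y)) else 0) =
        (\<Sum>x\<in>UNIV. \<psi> (b * F x) * cnj (\<psi> (b * F (x - d))))"
    proof (intro sum.cong refl)
      fix x :: 'a
      have "(- x + d = - y) = (y = x - d)" for y by (auto simp: algebra_simps eq_neg_iff_add_eq_0)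
      then show "(\<Sum>y\<in>UNIV. if - x + d = - y then \<psi> (b * F x) * cnj (\<psi> (b * F y)) else 0) =
          \<psi> (b * F x) * cnj (\<psi> (b * F (x - d)))" by simp
    qed
    also have "\<dots> = (\<Sum>x\<in>UNIV. \<psi> (b * (F (x + d) - F x)))"
      by (rule sum.reindex_bij_witness[of _ "\<lambda>x. x + d" "\<lambda>x. x - d"])
        (auto simp: right_diff_distrib simp flip: char_minus char_add)
    finally show "(\<Sum>x\<in>UNIV. \<psi> (b * (F (x + d) - F x))) = 0" by simp
  qed
qed

lemma parseval:
  "(\<Sum>a\<in>UNIV. (cmod (\<Sum>x\<in>UNIV. \<psi> (f x - a * x)))\<^sup>2) = (of_nat CARD('a))\<^sup>2"
proof -
  have "complex_of_real (\<Sum>a\<in>UNIV. (cmod (\<Sum>x\<in>UNIV. \<psi> (f x - a * x)))\<^sup>2) =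
     (\<Sum>a\<in>UNIV. of_real ((cmod (\<Sum>x\<in>UNIV. \<psi> (f x) * \<psi> (a * - x)))\<^sup>2) * \<psi> (a * 0))"
    by (simp add: char_0 flip: char_add)
  also have "\<dots> = (of_nat CARD('a))\<^sup>2"
    unfolding sum_norm_square_char_sum
    by (simp add: char_0 power2_eq_square flip: char_minus char_add)
  also have "\<dots> = complex_of_real ((of_nat CARD('a))\<^sup>2)" by simp
  finally show ?thesis by (simp only: of_real_eq_iff)
qed

text \<open>The surviving pairs are those with \<open>F x = F y\<close>; grouped by the common value
  they number the sum of the squared fibre sizes.\<close>

lemma sum_norm_square_at_0:
  fixes F :: "'a \<Rightarrow> 'a"
  shows "(\<Sum>b\<in>UNIV. (cmod (\<Sum>x\<in>UNIV. \<psi> (b * F x)))\<^sup>2) =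
    of_nat (CARD('a) * (\<Sum>y\<in>UNIV. (card (F -` {y}))\<^sup>2))"
proof -
  have "complex_of_real (\<Sum>b\<in>UNIV. (cmod (\<Sum>x\<in>UNIV. \<psi> (b * F x)))\<^sup>2) =
     (\<Sum>b\<in>UNIV. of_real ((cmod (\<Sum>x\<in>UNIV. 1 * \<psi> (b * F x)))\<^sup>2) * \<psi> (b * 0))"
    by (simp add: char_0)
  also have "\<dots> = of_nat (CARD('a) * (\<Sum>x\<in>UNIV. card (F -` {F x})))"
  proof -
    have "{y. F x = F y} = F -` {F x}" for x by auto
    then show ?thesis unfolding sum_norm_square_char_sum by (simp add: sum.If_cases)
  qed
  also have "(\<Sum>x\<in>UNIV. card (F -` {F x})) = (\<Sum>y\<in>UNIV. \<Sum>x | x \<in> UNIV \<and> F x = y. card (F -` {F x}))"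
    by (rule sum.group[symmetric]) auto
  also have "\<dots> = (\<Sum>y\<in>UNIV. (card (F -` {y}))\<^sup>2)"
  proof (intro sum.cong refl)
    fix y
    have "{x. x \<in> UNIV \<and> F x = y} = F -` {y}" by auto
    then show "(\<Sum>x | x \<in> UNIV \<and> F x = y. card (F -` {F x})) = (card (F -` {y}))\<^sup>2"
      by (simp add: power2_eq_square)
  qed
  also have "complex_of_nat (CARD('a) * (\<Sum>y\<in>UNIV. (card (F -` {y}))\<^sup>2)) =
      complex_of_real (of_nat (CARD('a) * (\<Sum>y\<in>UNIV. (card (F -` {y}))\<^sup>2)))"
    by (rule of_real_of_nat_eq[symmetric])
  finally show ?thesis by (simp only: of_real_eq_iff)
qed

end

section \<open>Fibres and character sums of 2-to-1 maps\<close>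

text \<open>The fibres of sizes \<open>1\<close> and \<open>2\<close> already contain
  \<open>1 + (CARD('a) - 1)\<close> points, so every other fibre is empty. An arbitrary
  \<open>g\<close> allows both a character sum and a count of squared fibre sizes to be evaluated
  this way.\<close>

lemma two_to_one_sum_fibres:
  fixes F :: "'a :: finite_field \<Rightarrow> 'a"
  assumes "two_to_one F"
  obtains y0 where "\<And>g :: nat \<Rightarrow> 'a \<Rightarrow> 'b :: comm_monoid_add. (\<And>y. g 0 y = 0) \<Longrightarrow>
      (\<Sum>y\<in>UNIV. g (card (F -` {y})) y) = g 1 y0 + (\<Sum>y | card (F -` {y}) = 2. g 2 y)"
proof -
  define S where "S k = {y. card (F -` {y}) = k}" for k
  obtain y0 where y0: "S 1 = {y0}"
    using assms by (auto simp: two_to_one_def S_def card_1_singleton_iff)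
  have card2: "2 * card (S 2) = CARD('a) - 1"
    using assms by (simp add: two_to_one_def S_def)
  have disj: "S 1 \<inter> S 2 = {}" by (auto simp: S_def)
  have split: "(\<Sum>y\<in>UNIV. h y) = (\<Sum>y\<in>S 1 \<union> S 2. h y) + (\<Sum>y\<in>- (S 1 \<union> S 2). h y)"
    for h :: "'a \<Rightarrow> 'c :: comm_monoid_add"
    using sum.subset_diff[of "S 1 \<union> S 2" UNIV h]
    by (simp only: Compl_eq_Diff_UNIV add.commute finite subset_UNIV simp_thms)
  have "CARD('a) = (\<Sum>y\<in>UNIV. card (F -` {y}))"
  proof -
    have "(\<Sum>y\<in>UNIV. \<Sum>x | x \<in> UNIV \<and> F x = y. 1) = (\<Sum>x\<in>(UNIV :: 'a set). (1::nat))"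
      by (rule sum.group) auto
    moreover have "{x. F x = y} = F -` {y}" for y by auto
    ultimately show ?thesis by simp
  qed
  also have "\<dots> = 1 + 2 * card (S 2) + (\<Sum>y\<in>- (S 1 \<union> S 2). card (F -` {y}))"
  proof -
    have "(\<Sum>y\<in>S 1 \<union> S 2. card (F -` {y})) = (\<Sum>y\<in>S 1. card (F -` {y})) + (\<Sum>y\<in>S 2. card (F -` {y}))"
      by (rule sum.union_disjoint) (auto simp: S_def)
    also have "(\<Sum>y\<in>S 1. card (F -` {y})) = (\<Sum>y\<in>S 1. 1)" by (rule sum.cong) (auto simp: S_def)
    also have "(\<Sum>y\<in>S 2. card (F -` {y})) = (\<Sum>y\<in>S 2. 2)" by (rule sum.cong) (auto simp: S_def)
    finally have "(\<Sum>y\<in>S 1 \<union> S 2. card (F -` {y})) = (\<Sum>y\<in>S 1. 1) + (\<Sum>y\<in>S 2. 2)" .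
    then show ?thesis by (subst split) (simp only: y0, simp)
  qed
  finally have "(\<Sum>y\<in>- (S 1 \<union> S 2). card (F -` {y})) = 0"
    using card2 by (simp add: Suc_leI)
  then have zero: "card (F -` {y}) = 0" if "y \<in> - (S 1 \<union> S 2)" for y
    using that by (metis finite sum_eq_0_iff)
  show ?thesis
  proof (rule that[of y0])
    fix g :: "nat \<Rightarrow> 'a \<Rightarrow> 'b" assume g: "\<And>y. g 0 y = 0"
    have "(\<Sum>y\<in>UNIV. g (card (F -` {y})) y) =
        (\<Sum>y\<in>S 1. g (card (F -` {y})) y) + (\<Sum>y\<in>S 2. g (card (F -` {y})) y)"
      by (subst split, subst sum.union_disjoint) (simp_all add: zero g disj[unfolded One_nat_def])
    also have "(\<Sum>y\<in>S 1. g (card (F -` {y})) y) = (\<Sum>y\<in>S 1. g 1 y)"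
      by (rule sum.cong) (auto simp: S_def)
    also have "(\<Sum>y\<in>S 2. g (card (F -` {y})) y) = (\<Sum>y\<in>S 2. g 2 y)"
      by (rule sum.cong) (auto simp: S_def)
    finally show "(\<Sum>y\<in>UNIV. g (card (F -` {y})) y) = g 1 y0 + (\<Sum>y | card (F -` {y}) = 2. g 2 y)"
      by (simp add: y0[unfolded One_nat_def]) (simp add: S_def)
  qed
qed

text \<open>As \<open>2 \<noteq> 0\<close>, the elements \<open>x\<close> and \<open>- x\<close>
  differ unless \<open>x = 0\<close>. Hence only \<open>F 0\<close> has a singleton fibre, and the
  nonzero elements pair off.\<close>

lemma two_to_one_if_planar_even:
  fixes F :: "'a :: finite_field \<Rightarrow> 'a"
  assumes two: "(2 :: 'a) \<noteq> 0" and even: "\<And>x. F (- x) = F x" and "planar F"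
  shows "two_to_one F"
proof -
  have eqD: "y = x \<or> y = - x" if "F x = F y" for x y
  proof (rule disjCI)
    assume "y \<noteq> - x"
    show "y = x"
    proof (rule ccontr)
      assume "y \<noteq> x"
      then have "y - x \<noteq> 0" by simp
      then have "\<exists>!z. F (z + (y - x)) - F z = 0"
        using \<open>planar F\<close> unfolding planar_def by blast
      moreover have "F (x + (y - x)) - F x = 0" "F (- y + (y - x)) - F (- y) = 0"
        using that by (simp_all add: even)
      ultimately have "x = - y" by blast
      with \<open>y \<noteq> - x\<close> show False by simp
    qed
  qed
  have "F z = F x \<longleftrightarrow> z = x \<or> z = - x" for x z
    using eqD[of x z] even[of x] by metis
  then have fibre: "F -` {F x} = {x, - x}" for x
    by auto
  have neg: "- x = x \<longleftrightarrow> x = 0" for x :: 'a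
  proof
    assume "- x = x"
    then have "x + x = 0" by (simp add: neg_eq_iff_add_eq_0)
    then have "2 * x = 0" by (simp only: mult_2)
    then show "x = 0" using two by (metis mult_eq_0_iff)
  qed simp
  have card_fibre: "card (F -` {F x}) = (if x = 0 then 1 else 2)" for x
    using neg[of x] by (auto simp: fibre card_insert_if)
  have range: "y \<in> range F" if "card (F -` {y}) > 0" for y
  proof (rule ccontr)
    assume "y \<notin> range F"
    then have "F -` {y} = {}" by auto
    with that show False by simp
  qed
  have card_iff: "card (F -` {y}) = k \<longleftrightarrow> (\<exists>x. y = F x \<and> k = (if x = 0 then 1 else 2))"
    if "k > 0" for y k
  proof
    assume k: "card (F -` {y}) = k"
    with that obtain x where "y = F x" using range[of y] by blast
    with k card_fibre[of x] show "\<exists>x. y = F x \<and> k = (if x = 0 then 1 else 2)" by blast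
  qed (use card_fibre in blast)
  have S1: "{y. card (F -` {y}) = 1} = {F 0}"
    by (subst card_iff) (simp_all add: if_distrib)
  have S2: "{y. card (F -` {y}) = 2} = F ` (UNIV - {0})"
    by (subst card_iff) (auto split: if_splits)
  \<comment> \<open>The nonzero elements are counted through their images, each of which is hit
    exactly twice.\<close>
  have "CARD('a) - 1 = card (UNIV - {0 :: 'a})" by (simp add: card_Diff_singleton)
  also have "\<dots> = (\<Sum>y\<in>F ` (UNIV - {0}). card {x \<in> UNIV - {0}. F x = y})"
    using sum.image_gen[of "UNIV - {0 :: 'a}" "\<lambda>_. 1 :: nat" F] by simp
  also have "\<dots> = (\<Sum>y\<in>F ` (UNIV - {0}). 2)"
  proof (intro sum.cong refl)
    fix y assume "y \<in> F ` (UNIV - {0})"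
    then obtain x where x: "x \<noteq> 0" "y = F x" by auto
    then have "{z \<in> UNIV - {0}. F z = y} = F -` {F x}"
      using fibre[of x] by auto
    then show "card {z \<in> UNIV - {0}. F z = y} = 2" using x card_fibre by simp
  qed
  finally show ?thesis unfolding two_to_one_def S1 S2 by simp
qed

text \<open>An even-odd count: \<open>F\<close> hits one value once and every other value an even number of times.\<close>
lemma (in additive_character) two_to_one_char_sum_nonzero:
  assumes "two_to_one F"
  shows "(\<Sum>x\<in>UNIV. \<psi> (b * F x)) \<noteq> 0"
proof -
  obtain y0 where y0: "\<And>g :: nat \<Rightarrow> 'a \<Rightarrow> complex. (\<And>y. g 0 y = 0) \<Longrightarrow>
      (\<Sum>y\<in>UNIV. g (card (F -` {y})) y) = g 1 y0 + (\<Sum>y | card (F -` {y}) = 2. g 2 y)"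
    using two_to_one_sum_fibres[OF assms] by blast
  have "(\<Sum>x\<in>UNIV. \<psi> (b * F x)) = (\<Sum>y\<in>UNIV. \<Sum>x | x \<in> UNIV \<and> F x = y. \<psi> (b * F x))"
    by (rule sum.group[symmetric]) auto
  also have "\<dots> = (\<Sum>y\<in>UNIV. of_nat (card (F -` {y})) * \<psi> (b * y))"
  proof (intro sum.cong refl)
    fix y
    have "{x. x \<in> UNIV \<and> F x = y} = F -` {y}" by auto
    then show "(\<Sum>x | x \<in> UNIV \<and> F x = y. \<psi> (b * F x)) = of_nat (card (F -` {y})) * \<psi> (b * y)"
      by simp
  qed
  also have "\<dots> = \<psi> (b * y0) + 2 * (\<Sum>y | card (F -` {y}) = 2. \<psi> (b * y))"
    by (subst y0) (simp_all add: sum_distrib_left)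
  also have "\<dots> \<noteq> 0"
    by (rule root_of_unity_plus_even_sum_nonzero[of "CARD('a)"]) (simp_all add: char_power_card)
  finally show ?thesis .
qed

text \<open>With \<open>q = CARD('a)\<close>, the squared fibre sizes add up to
  \<open>1 + 4 * (q - 1) / 2 = 2 * q - 1\<close>. The total over all \<open>b\<close> is therefore
  \<open>q * (2 * q - 1)\<close>, and removing the term \<open>q\<^sup>2\<close> at
  \<open>b = 0\<close> leaves \<open>q * (q - 1)\<close>.\<close>

lemma (in additive_character) two_to_one_sum_norm_square:
  assumes "two_to_one F"
  shows "(\<Sum>b\<in>UNIV - {0}. (cmod (\<Sum>x\<in>UNIV. \<psi> (b * F x)))\<^sup>2) =
    (\<Sum>b\<in>UNIV - {0 :: 'a}. of_nat CARD('a))"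
proof -
  let ?q = "CARD('a)"
  have q: "?q > 0" by simp
  obtain y0 where y0: "\<And>g :: nat \<Rightarrow> 'a \<Rightarrow> nat. (\<And>y. g 0 y = 0) \<Longrightarrow>
      (\<Sum>y\<in>UNIV. g (card (F -` {y})) y) = g 1 y0 + (\<Sum>y | card (F -` {y}) = 2. g 2 y)"
    using two_to_one_sum_fibres[OF assms] by blast
  have "(\<Sum>y\<in>UNIV. (card (F -` {y}))\<^sup>2) = 1 + 4 * card {y. card (F -` {y}) = 2}"
    by (subst y0) simp_all
  also have "\<dots> = 2 * ?q - 1"
    using assms q unfolding two_to_one_def by linarith
  finally have "(\<Sum>b\<in>UNIV. (cmod (\<Sum>x\<in>UNIV. \<psi> (b * F x)))\<^sup>2) = of_nat ?q * (2 * of_nat ?q - 1)"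
    using q by (simp add: sum_norm_square_at_0 of_nat_diff)
  moreover have "(\<Sum>b\<in>UNIV. (cmod (\<Sum>x\<in>UNIV. \<psi> (b * F x)))\<^sup>2) =
      (of_nat ?q)\<^sup>2 + (\<Sum>b\<in>UNIV - {0}. (cmod (\<Sum>x\<in>UNIV. \<psi> (b * F x)))\<^sup>2)"
    by (subst sum.remove[of _ 0]) (simp_all add: char_0)
  moreover have "real (card (UNIV - {0 :: 'a})) = of_nat ?q - 1"
    using q by (simp add: card_Diff_singleton of_nat_diff)
  ultimately show ?thesis by (simp add: power2_eq_square algebra_simps)
qed

section \<open>The trace character and the Walsh transform\<close>

lemma abs_trace_add:
  assumes "prime p" "CARD('a :: finite_field) = p ^ n"
  shows "abs_trace p n (x + y :: 'a) = abs_trace p n x + abs_trace p n y"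
proof -
  have p: "CHAR('a) = p" using CHAR_eq_if_card_eq_power assms by blast
  have "(x + y) ^ p ^ i = x ^ p ^ i + y ^ p ^ i" for i
    by (rule freshmans_dream'[of _ i]) (simp_all add: p assms)
  then show ?thesis by (simp add: abs_trace_def sum.distrib)
qed

text \<open>The trace is a nonzero polynomial of degree \<open>p ^ (n - 1)\<close>, so it cannot vanish on the whole field.\<close>
lemma abs_trace_not_zero:
  assumes "prime p" "CARD('a :: finite_field) = p ^ n"
  shows "\<exists>x :: 'a. abs_trace p n x \<noteq> 0"
proof (rule ccontr)
  assume "\<not> ?thesis"
  then have zero: "abs_trace p n x = 0" for x :: 'a by blast
  have p2: "p \<ge> 2" using assms(1) prime_ge_2_nat by blast
  have "CARD('a) \<noteq> 1" by (metis card_1_singletonE singletonD UNIV_I zero_neq_one)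
  then obtain m where n: "n = Suc m" using assms(2) by (cases n) auto
  define f :: "'a poly" where "f = (\<Sum>i<n. Polynomial.monom 1 (p ^ i))"
  \<comment> \<open>The exponents \<open>p ^ i\<close> are distinct, so the top monomial does not
    cancel.\<close>
  have "Polynomial.coeff f (p ^ m) = (\<Sum>i<n. if i = m then 1 else 0)"
    unfolding f_def coeff_sum using p2
    by (intro sum.cong refl) (simp add: power_inject_exp)
  then have "f \<noteq> 0" using n by auto
  moreover have "degree f \<le> p ^ m"
    unfolding f_def using p2 n
    by (intro degree_sum_le order.trans[OF degree_monom_le] power_increasing) auto
  moreover have "{x. poly f x = 0} = UNIV"
    using zero by (auto simp: f_def poly_sum poly_monom abs_trace_def)
  ultimately have "CARD('a) \<le> p ^ m"
    using card_poly_roots_bound[of f] by simp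
  then show False using assms(2) p2 n by (simp add: power_strict_increasing_iff not_le)
qed

text \<open>This is the canonical additive character of the field.\<close>

definition trace_char :: "nat \<Rightarrow> nat \<Rightarrow> 'a :: finite_field \<Rightarrow> complex" where
  "trace_char p n x = zeta p ^ prime_field_rep p (abs_trace p n x)"

lemma zeta_nonzero: "zeta p \<noteq> 0"
  by (simp add: zeta_def)

lemma zeta_power_eq_1_iff:
  assumes "p > 0"
  shows "zeta p ^ k = 1 \<longleftrightarrow> p dvd k"
proof -
  have "zeta p ^ k = exp (2 * of_real pi * \<i> * of_nat k / of_nat p)"
    by (simp add: zeta_def exp_of_nat_mult[symmetric] mult_ac)
  then show ?thesis using complex_root_unity_eq_1[of p k] assms by simp
qed

lemma zeta_power_mod:
  assumes "p > 0"
  shows "zeta p ^ (k mod p) = zeta p ^ k"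
proof -
  have "zeta p ^ k = zeta p ^ (p * (k div p) + k mod p)" by simp
  also have "\<dots> = zeta p ^ (k mod p)"
    using zeta_power_eq_1_iff[OF assms] by (simp only: power_add) simp
  finally show ?thesis ..
qed

text \<open>The representatives below \<open>p\<close> are additive only modulo \<open>p\<close>,
  which suffices because the powers of \<open>zeta p\<close> have period \<open>p\<close>. The
  character is \<open>1\<close> exactly where the trace vanishes, so a nonzero trace value makes it
  nontrivial.\<close>

lemma additive_character_trace_char:
  assumes "prime p" "CARD('a :: finite_field) = p ^ n"
  shows "additive_character (trace_char p n :: 'a \<Rightarrow> complex)"
proof
  let ?r = "\<lambda>x :: 'a. prime_field_rep p (abs_trace p n x)"
  have p: "CHAR('a) = p" using CHAR_eq_if_card_eq_power assms by blast
  have p0: "p > 0" using assms(1) prime_gt_0_nat by blast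
  have r: "?r x < p" "of_nat (?r x) = abs_trace p n x" for x
    using theI'[OF ex1_prime_field_rep_abs_trace[OF assms, of x]] by (auto simp: prime_field_rep_def)
  show "trace_char p n (x + y) = trace_char p n x * trace_char p n y" for x y :: 'a
  proof -
    have "(of_nat (?r (x + y)) :: 'a) = of_nat (?r x + ?r y)"
      unfolding of_nat_add r(2) by (rule abs_trace_add[OF assms])
    then have "?r (x + y) mod p = (?r x + ?r y) mod p"
      by (simp only: of_nat_eq_iff_cong_CHAR p cong_def)
    then show ?thesis
      unfolding trace_char_def by (metis p0 power_add zeta_power_mod)
  qed
  have eq_1: "trace_char p n x = 1 \<longleftrightarrow> abs_trace p n x = 0" for x :: 'a
  proof -
    have "trace_char p n x = 1 \<longleftrightarrow> p dvd ?r x"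
      unfolding trace_char_def by (rule zeta_power_eq_1_iff[OF p0])
    also have "\<dots> \<longleftrightarrow> (of_nat (?r x) :: 'a) = 0" by (simp only: of_nat_eq_0_iff_char_dvd p)
    finally show ?thesis by (simp only: r)
  qed
  have "abs_trace p n 0 = (0 :: 'a)" using p0 by (simp add: abs_trace_def power_0_left)
  then show "trace_char p n (0 :: 'a) = 1" by (simp only: eq_1)
  show "\<exists>c :: 'a. trace_char p n c \<noteq> 1" using abs_trace_not_zero[OF assms] by (simp only: eq_1)
qed

text \<open>The exponent in \<open>walsh_transform\<close> is a difference of two representatives
  and may be negative; multiplicativity of the character identifies the power with the character of
  the difference.\<close>

lemma walsh_transform_trace_char:
  fixes F :: "'a :: finite_field \<Rightarrow> 'a"
  assumes "prime p" "CARD('a) = p ^ n"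
  shows "walsh_transform p n F b a = (\<Sum>x\<in>UNIV. trace_char p n (b * F x - a * x))"
proof -
  interpret additive_character "trace_char p n :: 'a \<Rightarrow> complex"
    by (rule additive_character_trace_char[OF assms])
  have "trace_char p n (u - v) = zeta p powi
      (int (prime_field_rep p (abs_trace p n u)) - int (prime_field_rep p (abs_trace p n v)))" for u v :: 'a
  proof -
    have "trace_char p n (u - v) * trace_char p n v = trace_char p n u"
      by (simp flip: char_add)
    then show ?thesis
      by (simp add: trace_char_def power_int_diff zeta_nonzero field_simps)
  qed
  then show ?thesis unfolding walsh_transform_def by simp
qed

section \<open>Planarity versus 2-to-1 for even plateaued functions\<close>

theorem corollary6p5:
  fixes p n :: nat and F :: "'a :: finite_field \<Rightarrow> 'a"
  assumes "prime p" and "odd p"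
    and "CARD('a) = p ^ n"
    and "plateaued p n F"
    and "\<And>x. F x = F (- x)"
  shows "planar F \<longleftrightarrow> two_to_one F"
proof
  have "CHAR('a) = p" using CHAR_eq_if_card_eq_power assms by blast
  then have "of_nat 2 \<noteq> (0 :: 'a)"
    using assms(1,2) by (metis of_nat_eq_0_iff_char_dvd primes_dvd_imp_eq two_is_prime_nat dvd_refl)
  then have two: "(2 :: 'a) \<noteq> 0" by simp
  show "two_to_one F" if "planar F"
    using two assms(5)[symmetric] that by (rule two_to_one_if_planar_even)
next
  assume F: "two_to_one F"
  interpret additive_character "trace_char p n :: 'a \<Rightarrow> complex"
    by (rule additive_character_trace_char[OF assms(1,3)])
  let ?q = "real CARD('a)"
  \<comment> \<open>Squaring removes the half-integral exponents: the plateau values become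
    \<open>0\<close> and \<open>?q * real p ^ s\<close>.\<close>
  define W where "W b a = (cmod (\<Sum>x\<in>UNIV. trace_char p n (b * F x - a * x)))\<^sup>2" for b a
  have p1: "real p \<ge> 1" using prime_ge_1_nat[OF assms(1)] by simp
  have powr: "(real p powr ((real n + real s) / 2))\<^sup>2 = ?q * real p ^ s" for s
  proof -
    have "(real p powr ((real n + real s) / 2))\<^sup>2 = real p powr (real (n + s))"
      by (simp only: power2_eq_square powr_add[symmetric] field_sum_of_halves of_nat_add)
    also have "\<dots> = real p ^ (n + s)" using p1 by (subst powr_realpow) auto
    finally show ?thesis by (simp add: power_add assms(3))
  qed
  have plat: "\<exists>s. \<forall>a. W b a \<in> {0, ?q * real p ^ s}" if "b \<noteq> 0" for b
  proof -
    obtain s where "\<And>a. cmod (walsh_transform p n F b a) \<in> {0, real p powr ((real n + real s) / 2)}"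
      using assms(4) \<open>b \<noteq> 0\<close> unfolding plateaued_def by blast
    then have "W b a \<in> {0, ?q * real p ^ s}" for a
      unfolding W_def walsh_transform_trace_char[OF assms(1,3), symmetric] powr[symmetric]
      by (metis insert_iff power_zero_numeral singletonD)
    then show ?thesis by blast
  qed
  have nz: "W b 0 \<noteq> 0" for b
    using two_to_one_char_sum_nonzero[OF F, of b] by (simp add: W_def)
  have ge: "?q \<le> W b 0" if b: "b \<noteq> 0" for b
  proof -
    obtain s where "W b 0 = ?q * real p ^ s" using plat[OF b] nz[of b] by blast
    moreover have "1 \<le> real p ^ s" using p1 by simp
    ultimately show ?thesis by simp
  qed
  have "(\<Sum>b\<in>UNIV - {0 :: 'a}. ?q) = (\<Sum>b\<in>UNIV - {0}. W b 0)"
    using two_to_one_sum_norm_square[OF F] by (simp add: W_def)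
  \<comment> \<open>Each term is at least \<open>?q\<close> and the totals agree, so equality holds
    term by term.\<close>
  then have at_0: "W b 0 = ?q" if "b \<noteq> 0" for b
    using sum_mono_inv[of "\<lambda>_. ?q" "UNIV - {0}" "\<lambda>b. W b 0" b] ge that by simp
  have "W b a = ?q" if b: "b \<noteq> 0" for b a
  proof -
    \<comment> \<open>One \<open>s\<close> serves all arguments for a fixed \<open>b\<close>. The
      nonzero plateau value is attained at \<open>0\<close>, where it equals \<open>?q\<close>, so
      it bounds the whole spectrum; Parseval then forces equality everywhere.\<close>
    have le: "W b c \<le> ?q" for c
    proof -
      obtain s where s: "\<And>a. W b a \<in> {0, ?q * real p ^ s}" using plat[OF b] by blast
      have "W b 0 = ?q * real p ^ s" using s[of 0] nz[of b] by blast
      then show ?thesis using s[of c] at_0[OF b] by auto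
    qed
    have "(\<Sum>a\<in>UNIV. W b a) = (\<Sum>a\<in>(UNIV :: 'a set). ?q)"
      using parseval[of "\<lambda>x. b * F x"] by (simp add: W_def power2_eq_square)
    then show ?thesis
      using sum_mono_inv[of "W b" UNIV "\<lambda>_. ?q" a] le by simp
  qed
  then show "planar F"
    unfolding W_def by (rule planar_if_flat_spectrum)
qed

end
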